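(* Let $P\subset\mathbb{R}^n$ be a rational polytope of dimension $n$ containing the origin, such that its dual $P^\vee=\{u\in\mathbb{R}^n\mid \langle u,v\rangle\le 1\text{ for all }v\in P\}$ is a lattice polytope (i.e. a polytope with all vertices in $\mathbb{Z}^n$). Let $k$ be the smallest positive integer such that $kP$ is a lattice polytope. For each $r\in\{0,1,\dots,k-1\}$ let $L_{P,r}$ be the polynomial in $l$ of degree $n$ with $L_{P,r}(l)=|(lk+r)P\cap\mathbb{Z}^n|$ for all integers $l\ge 0$, and define integers $\delta_{0,r},\dots,\delta_{n,r}$ by $$\sum_{l\ge 0}L_{P,r}(l)t^l=\frac{\delta_{0,r}+\delta_{1,r}t+\dots+\delta_{n,r}t^n}{(1-t)^{n+1}}.$$ Then $\delta_{i,r}=\delta_{n-i,k-r-1}$ for all $0\le i\le n$ and $0\le r\le k-1$.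
   Context: A rational polytope is the convex hull of finitely many points of $\mathbb{Q}^n$. For a rational polytope $P$ and $m\in\mathbb{Z}_{\ge0}$, the number $L_P(m)=|mP\cap\mathbb{Z}^n|$ of lattice points in the dilate $mP$ is a quasi-polynomial in $m$ whose period divides $k$, so that for each residue $r$ the function $l\mapsto L_P(lk+r)$ agrees with a polynomial $L_{P,r}$ of degree $n$. *)

theory Defs
  imports
    "HOL-Analysis.Analysis"
    "HOL-Computational_Algebra.Computational_Algebra"
begin

definition int_lattice :: "(real ^ 'n) set" where
  "int_lattice = {x. \<forall>i. vec_nth x i \<in> \<int>}"

definition rational_polytope :: "(real ^ 'n) set \<Rightarrow> bool" where
  "rational_polytope P \<longleftrightarrow>
     (\<exists>V. finite V \<and> (\<forall>v\<in>V. \<forall>i. vec_nth v i \<in> \<rat>) \<and> P = convex hull V)"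

definition lattice_polytope :: "(real ^ 'n) set \<Rightarrow> bool" where
  "lattice_polytope P \<longleftrightarrow>
     polytope P \<and> (\<forall>v. v extreme_point_of P \<longrightarrow> v \<in> int_lattice)"

definition dual_polytope :: "(real ^ 'n) set \<Rightarrow> (real ^ 'n) set" where
  "dual_polytope P = {u. \<forall>v\<in>P. u \<bullet> v \<le> 1}"

definition dilate :: "nat \<Rightarrow> (real ^ 'n) set \<Rightarrow> (real ^ 'n) set" where
  "dilate m P = (\<lambda>x. real m *\<^sub>R x) ` P"

definition lattice_count :: "(real ^ 'n) set \<Rightarrow> nat \<Rightarrow> nat" where
  "lattice_count P m = card (dilate m P \<inter> int_lattice)"

end

theory Submission imports Defs begin

text \<open>
  Let \<open>V\<close> be the set of vertices of the dual polytope and \<open>g x = max {u \<bullet> x | u \<in> V}\<close> the gauge of \<open>P\<close>.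
  It takes integer values on lattice points, and \<open>m P = {x. g x \<le> m}\<close>, so the Ehrhart series of \<open>P\<close>
  times \<open>1 - t\<close> is the sum of \<open>t ^ g x\<close> over all lattice points \<open>x\<close>.  Cutting the orthants along the
  hyperplanes \<open>(u - v) \<bullet> x = 0\<close> gives a simplicial fan on whose cones \<open>g\<close> is linear; after rescaling,
  all its generators are lattice vectors with the same gauge \<open>N\<close>.  A generic direction \<open>\<xi>\<close> makes the
  cones half-open, so that they partition the lattice, and each of them contributes the series of its
  fundamental parallelepiped divided by \<open>(1 - t ^ N) ^ n\<close>.  Reflecting a parallelepiped in its centre
  exchanges the half-open structures of \<open>\<xi>\<close> and \<open>- \<xi>\<close>, which yield the same total, so the
  numerator is palindromic.  Comparing with the denominator \<open>(1 - t ^ k) ^ (n + 1)\<close> transfers the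
  symmetry to the polynomial with coefficient \<open>\<delta> i r\<close> at \<open>t ^ (i * k + r)\<close>.
\<close>

section \<open>Simplicial fans adapted to a hyperplane arrangement\<close>

definition dual_bases :: "('n \<Rightarrow> real ^ 'n) \<Rightarrow> ('n \<Rightarrow> real ^ 'n) \<Rightarrow> bool" where
  "dual_bases w c \<longleftrightarrow> (\<forall>y. y = (\<Sum>i\<in>UNIV. (c i \<bullet> y) *\<^sub>R w i)) \<and>
     (\<forall>i j. c i \<bullet> w j = (if i = j then 1 else 0))"

text \<open>A simplicial cone is stored as its generators together with the dual basis, which gives the
  coordinates of a point with respect to the generators.\<close>

type_synonym 'n framed_cone = "('n \<Rightarrow> real ^ 'n) \<times> ('n \<Rightarrow> real ^ 'n)"

definition lattice_cone :: "'n::finite framed_cone \<Rightarrow> bool" where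
  "lattice_cone B \<longleftrightarrow> dual_bases (fst B) (snd B) \<and> (\<forall>i. fst B i \<in> int_lattice)"

text \<open>The walls are the whole hyperplanes spanned by the facets, so points outside the cone
  are constrained as well. This is the notion of a generic point.\<close>

definition off_walls :: "'n::finite framed_cone \<Rightarrow> real ^ 'n \<Rightarrow> bool" where
  "off_walls B y \<longleftrightarrow> (\<forall>i. snd B i \<bullet> y \<noteq> 0)"

definition in_open_cone :: "'n::finite framed_cone \<Rightarrow> real ^ 'n \<Rightarrow> bool" where
  "in_open_cone B y \<longleftrightarrow> (\<forall>i. snd B i \<bullet> y > 0)"

text \<open>On the cone, \<open>h\<close> is a nonnegative combination of its values at the
  generators, so this says that \<open>h\<close> does not change sign there.\<close>

definition one_sided :: "real ^ 'n::finite \<Rightarrow> 'n framed_cone \<Rightarrow> bool" where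
  "one_sided h B \<longleftrightarrow> (\<forall>i. 0 \<le> h \<bullet> fst B i) \<or> (\<forall>i. h \<bullet> fst B i \<le> 0)"

text \<open>Inclusion of closed cones is expressed by duality: a linear form nonnegative on
  \<open>B\<close> is nonnegative on every piece. Covering and disjointness are demanded at generic
  points only, so common faces need no bookkeeping.\<close>

definition subdivision :: "'n::finite framed_cone set \<Rightarrow> 'n framed_cone \<Rightarrow> bool" where
  "subdivision F B \<longleftrightarrow> finite F \<and>
     (\<forall>B'\<in>F. lattice_cone B' \<and> (\<forall>h. (\<forall>i. 0 \<le> h \<bullet> fst B i) \<longrightarrow> (\<forall>i. 0 \<le> h \<bullet> fst B' i))) \<and>
     (\<forall>y. (\<forall>B'\<in>F. off_walls B' y) \<longrightarrow> off_walls B y \<and>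
        (in_open_cone B y \<longrightarrow> (\<exists>!B'\<in>F. in_open_cone B' y)) \<and> (\<forall>B'\<in>F. in_open_cone B' y \<longrightarrow> in_open_cone B y))"

section \<open>Arithmetic of the integer lattice\<close>

lemma int_lattice_add: "x \<in> int_lattice \<Longrightarrow> y \<in> int_lattice \<Longrightarrow> x + y \<in> int_lattice"
  by (auto simp: int_lattice_def)

lemma int_lattice_diff: "x \<in> int_lattice \<Longrightarrow> y \<in> int_lattice \<Longrightarrow> x - y \<in> int_lattice"
  by (auto simp: int_lattice_def)

lemma int_lattice_scaleR: "a \<in> \<int> \<Longrightarrow> x \<in> int_lattice \<Longrightarrow> a *\<^sub>R x \<in> int_lattice"
  by (auto simp: int_lattice_def)

lemma int_lattice_sum: "(\<And>i. i \<in> I \<Longrightarrow> f i \<in> int_lattice) \<Longrightarrow> sum f I \<in> int_lattice"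
  by (auto simp: int_lattice_def intro!: Ints_sum)

lemma int_lattice_inner: "x \<in> int_lattice \<Longrightarrow> y \<in> int_lattice \<Longrightarrow> x \<bullet> y \<in> \<int>"
  by (auto simp: int_lattice_def inner_vec_def)

lemma finite_bounded_int_lattice:
  assumes "bounded S"
  shows "finite (S \<inter> int_lattice)"
proof -
  obtain r where r: "\<And>x. x \<in> S \<Longrightarrow> norm x \<le> r"
    using assms by (auto simp: bounded_iff)
  let ?I = "(of_int ` {-\<lceil>r\<rceil>..\<lceil>r\<rceil>}) :: real set"
  have "S \<inter> int_lattice \<subseteq> vec_lambda ` (UNIV \<rightarrow>\<^sub>E ?I)"
  proof
    fix x assume x: "x \<in> S \<inter> int_lattice"
    have "x $ i \<in> ?I" for i
    proof -
      obtain z where z: "x $ i = of_int z"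
        using x by (auto simp: int_lattice_def elim: Ints_cases)
      have "\<bar>x $ i\<bar> \<le> r"
        using component_le_norm_cart[of x i] r[of x] x by auto
      hence "\<bar>z\<bar> \<le> \<lceil>r\<rceil>" unfolding z by linarith
      thus ?thesis unfolding z by (intro imageI) (auto simp: abs_le_iff)
    qed
    hence "vec_nth x \<in> UNIV \<rightarrow>\<^sub>E ?I" by auto
    thus "x \<in> vec_lambda ` (UNIV \<rightarrow>\<^sub>E ?I)"
      by (metis imageI vec_nth_inverse)
  qed
  moreover have "finite (vec_lambda ` (UNIV \<rightarrow>\<^sub>E ?I) :: (real ^ 'a) set)"
    by (intro finite_imageI finite_PiE) auto
  ultimately show ?thesis by (rule finite_subset)
qed

text \<open>The coordinate at \<open>a\<close> is divided by \<open>p\<close>; the new vector then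
  already carries \<open>q / p\<close> times \<open>c a \<bullet> y\<close> of \<open>w b\<close>,
  which is taken off the coordinate at \<open>b\<close>.\<close>

lemma dual_bases_split:
  assumes B: "dual_bases w c" and ab: "a \<noteq> b" and p: "p \<noteq> 0"
  shows "dual_bases (w(a := p *\<^sub>R w a + q *\<^sub>R w b))
           (c(a := (1 / p) *\<^sub>R c a, b := c b - (q / p) *\<^sub>R c a))"
    (is "dual_bases ?w ?c")
proof -
  have split: "sum f UNIV = f a + (f b + sum f (UNIV - {a, b}))" for f :: "'a \<Rightarrow> real ^ 'a"
  proof -
    have "UNIV = insert a (insert b (UNIV - {a, b}))" by auto
    hence "sum f UNIV = sum f (insert a (insert b (UNIV - {a, b})))" by simp
    thus ?thesis using ab by simp
  qed
  have "y = (\<Sum>i\<in>UNIV. (?c i \<bullet> y) *\<^sub>R ?w i)" for y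
  proof -
    have "(\<Sum>i\<in>UNIV - {a, b}. (?c i \<bullet> y) *\<^sub>R ?w i) = (\<Sum>i\<in>UNIV - {a, b}. (c i \<bullet> y) *\<^sub>R w i)"
      by (intro sum.cong) auto
    hence "(\<Sum>i\<in>UNIV. (?c i \<bullet> y) *\<^sub>R ?w i) = (\<Sum>i\<in>UNIV. (c i \<bullet> y) *\<^sub>R w i)"
      unfolding split using ab p by (simp add: inner_simps algebra_simps)
    thus ?thesis using B by (simp add: dual_bases_def)
  qed
  moreover have "?c i \<bullet> ?w j = (if i = j then 1 else 0)" for i j
    using B ab p by (auto simp: dual_bases_def inner_simps)
  ultimately show ?thesis by (simp add: dual_bases_def)
qed

section \<open>Composing and constructing subdivisions\<close>

lemma subdivision_lattice_cone: "subdivision F B \<Longrightarrow> B' \<in> F \<Longrightarrow> lattice_cone B'"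
  unfolding subdivision_def by blast

lemma subdivision_nonneg:
  assumes "subdivision F B" "B' \<in> F" "\<forall>i. 0 \<le> h \<bullet> fst B i"
  shows "\<forall>i. 0 \<le> h \<bullet> fst B' i"
  using assms unfolding subdivision_def by blast

lemma subdivision_off_walls:
  assumes "subdivision F B" "\<And>B'. B' \<in> F \<Longrightarrow> off_walls B' y"
  shows "off_walls B y \<and> (in_open_cone B y \<longrightarrow> (\<exists>!B'\<in>F. in_open_cone B' y)) \<and>
    (\<forall>B'\<in>F. in_open_cone B' y \<longrightarrow> in_open_cone B y)"
proof -
  have "\<forall>B'\<in>F. off_walls B' y" using assms(2) by blast
  thus ?thesis
    by (rule assms(1)[unfolded subdivision_def, THEN conjunct2, THEN conjunct2, THEN spec, THEN mp])
qed

lemma subdivision_refl: "lattice_cone B \<Longrightarrow> subdivision {B} B"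
  by (auto simp: subdivision_def)

text \<open>A point generic for the finest pieces is generic for the intermediate cones, so the
  unique piece containing it is found by descending one level at a time.\<close>

lemma subdivision_trans:
  assumes F: "subdivision F B" and G: "\<And>B'. B' \<in> F \<Longrightarrow> subdivision (G B') B'"
  shows "subdivision (\<Union>B'\<in>F. G B') B"
  unfolding subdivision_def
proof (intro conjI ballI allI impI)
  show "finite (\<Union>B'\<in>F. G B')"
    using F G by (auto simp: subdivision_def)
next
  fix B' assume "B' \<in> (\<Union>B'\<in>F. G B')"
  thus "lattice_cone B'" using subdivision_lattice_cone[OF G] by blast
next
  fix B' h i assume B': "B' \<in> (\<Union>B'\<in>F. G B')" and h: "\<forall>i. 0 \<le> h \<bullet> fst B i"
  obtain C where C: "C \<in> F" "B' \<in> G C" using B' by blast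
  show "0 \<le> h \<bullet> fst B' i"
    using subdivision_nonneg[OF G[OF C(1)] C(2) subdivision_nonneg[OF F C(1) h]] by blast
next
  fix y assume y: "\<forall>B'\<in>\<Union>B'\<in>F. G B'. off_walls B' y"
  have GF: "off_walls B' y \<and>
      (in_open_cone B' y \<longrightarrow> (\<exists>!C\<in>G B'. in_open_cone C y)) \<and> (\<forall>C\<in>G B'. in_open_cone C y \<longrightarrow> in_open_cone B' y)"
    if "B' \<in> F" for B'
    by (rule subdivision_off_walls[OF G[OF that]]) (use y that in blast)
  have FB: "off_walls B y \<and>
        (in_open_cone B y \<longrightarrow> (\<exists>!B'\<in>F. in_open_cone B' y)) \<and> (\<forall>B'\<in>F. in_open_cone B' y \<longrightarrow> in_open_cone B y)"
    by (rule subdivision_off_walls[OF F]) (rule GF[THEN conjunct1])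
  show "off_walls B y" using FB by blast
  show "\<exists>!B'\<in>\<Union>B'\<in>F. G B'. in_open_cone B' y" if By: "in_open_cone B y"
  proof -
    obtain B' where B': "B' \<in> F" "in_open_cone B' y" and uni: "\<And>C. C \<in> F \<Longrightarrow> in_open_cone C y \<Longrightarrow> C = B'"
      using FB By by blast
    obtain C where C: "C \<in> G B'" "in_open_cone C y" "\<And>D. D \<in> G B' \<Longrightarrow> in_open_cone D y \<Longrightarrow> D = C"
      using GF[OF B'(1)] B'(2) by blast
    show ?thesis
    proof (rule ex1I[of _ C])
      show "C \<in> (\<Union>B'\<in>F. G B') \<and> in_open_cone C y" using B' C by blast
    next
      fix D assume "D \<in> (\<Union>B'\<in>F. G B') \<and> in_open_cone D y"
      then obtain E where "E \<in> F" "D \<in> G E" "in_open_cone D y" by blast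
      moreover from this have "in_open_cone E y" using GF by blast
      ultimately show "D = C" using uni C(3) by blast
    qed
  qed
  show "in_open_cone B y" if "B' \<in> (\<Union>B'\<in>F. G B')" "in_open_cone B' y" for B'
    using that GF FB by blast
qed

text \<open>The new generator lies inside the face spanned by \<open>w a\<close> and
  \<open>w b\<close>, and the hyperplane
  \<open>p * (c b \<bullet> y) = q * (c a \<bullet> y)\<close> separates the two pieces. Integral
  \<open>p\<close> and \<open>q\<close> keep the generator in the lattice.\<close>

lemma subdivision_split:
  fixes w c :: "'n::finite \<Rightarrow> real ^ 'n"
  assumes B: "lattice_cone (w, c)" and ab: "a \<noteq> b"
    and p: "p > 0" "p \<in> \<int>" and q: "q > 0" "q \<in> \<int>"
  defines "v \<equiv> p *\<^sub>R w a + q *\<^sub>R w b"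
  shows "subdivision
     {(w(a := v), c(a := (1 / p) *\<^sub>R c a, b := c b - (q / p) *\<^sub>R c a)),
      (w(b := v), c(b := (1 / q) *\<^sub>R c b, a := c a - (p / q) *\<^sub>R c b))} (w, c)"
    (is "subdivision {?B1, ?B2} _")
proof -
  have d: "dual_bases w c" and w: "\<And>i. w i \<in> int_lattice" using B by (auto simp: lattice_cone_def)
  have v: "v \<in> int_lattice"
    unfolding v_def by (intro int_lattice_add int_lattice_scaleR w p q)
  have d1: "dual_bases (fst ?B1) (snd ?B1)"
    using dual_bases_split[OF d ab, of p q] p by (simp add: v_def)
  have d2: "dual_bases (fst ?B2) (snd ?B2)"
    using dual_bases_split[OF d ab[symmetric], of q p] q by (simp add: v_def add.commute)
  have cones: "lattice_cone ?B1" "lattice_cone ?B2"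
    unfolding lattice_cone_def using d1 d2 v w by auto
  have nonneg: "0 \<le> h \<bullet> v" if "\<forall>i. 0 \<le> h \<bullet> w i" for h
    using that p q by (auto simp: v_def inner_simps)
  have all: "(\<forall>i. R i) \<longleftrightarrow> R a \<and> R b \<and> (\<forall>i. i \<noteq> a \<longrightarrow> i \<noteq> b \<longrightarrow> R i)" for R :: "'n \<Rightarrow> bool"
    by metis
  have in1: "in_open_cone ?B1 y \<longleftrightarrow> c a \<bullet> y > 0 \<and> p * (c b \<bullet> y) > q * (c a \<bullet> y) \<and>
      (\<forall>i. i \<noteq> a \<longrightarrow> i \<noteq> b \<longrightarrow> c i \<bullet> y > 0)" for y
    unfolding in_open_cone_def by (subst all) (use p q ab in \<open>auto simp: inner_simps field_simps\<close>)
  have in2: "in_open_cone ?B2 y \<longleftrightarrow> c b \<bullet> y > 0 \<and> p * (c b \<bullet> y) < q * (c a \<bullet> y) \<and>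
      (\<forall>i. i \<noteq> a \<longrightarrow> i \<noteq> b \<longrightarrow> c i \<bullet> y > 0)" for y
    unfolding in_open_cone_def by (subst all) (use p q ab in \<open>auto simp: inner_simps field_simps\<close>)
  have inB: "in_open_cone (w, c) y \<longleftrightarrow> c a \<bullet> y > 0 \<and> c b \<bullet> y > 0 \<and>
      (\<forall>i. i \<noteq> a \<longrightarrow> i \<noteq> b \<longrightarrow> c i \<bullet> y > 0)" for y
    unfolding in_open_cone_def by (subst all) auto
  have off1: "off_walls ?B1 y \<longleftrightarrow> c a \<bullet> y \<noteq> 0 \<and> p * (c b \<bullet> y) \<noteq> q * (c a \<bullet> y) \<and>
      (\<forall>i. i \<noteq> a \<longrightarrow> i \<noteq> b \<longrightarrow> c i \<bullet> y \<noteq> 0)" for y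
    unfolding off_walls_def by (subst all) (use p q ab in \<open>auto simp: inner_simps field_simps\<close>)
  have off2: "off_walls ?B2 y \<longleftrightarrow> c b \<bullet> y \<noteq> 0 \<and> p * (c b \<bullet> y) \<noteq> q * (c a \<bullet> y) \<and>
      (\<forall>i. i \<noteq> a \<longrightarrow> i \<noteq> b \<longrightarrow> c i \<bullet> y \<noteq> 0)" for y
    unfolding off_walls_def by (subst all) (use p q ab in \<open>auto simp: inner_simps field_simps\<close>)
  have offB: "off_walls (w, c) y \<longleftrightarrow> c a \<bullet> y \<noteq> 0 \<and> c b \<bullet> y \<noteq> 0 \<and>
      (\<forall>i. i \<noteq> a \<longrightarrow> i \<noteq> b \<longrightarrow> c i \<bullet> y \<noteq> 0)" for y
    unfolding off_walls_def by (subst all) auto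
  \<comment> \<open>In each piece, the coordinate missing from its list of conditions is forced to
    be positive by the separating inequality.\<close>
  have up1: "c b \<bullet> y > 0" if "c a \<bullet> y > 0" "p * (c b \<bullet> y) > q * (c a \<bullet> y)" for y
    using that p q mult_pos_pos[of q "c a \<bullet> y"] zero_less_mult_pos[of p "c b \<bullet> y"] by linarith
  have up2: "c a \<bullet> y > 0" if "c b \<bullet> y > 0" "p * (c b \<bullet> y) < q * (c a \<bullet> y)" for y
    using that p q mult_pos_pos[of p "c b \<bullet> y"] zero_less_mult_pos[of q "c a \<bullet> y"] by linarith
  have sub1: "in_open_cone ?B1 y \<Longrightarrow> in_open_cone (w, c) y" for y unfolding in1 inB using up1 by blast
  have sub2: "in_open_cone ?B2 y \<Longrightarrow> in_open_cone (w, c) y" for y unfolding in2 inB using up2 by blast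
  have disj: "\<not> (in_open_cone ?B1 y \<and> in_open_cone ?B2 y)" for y unfolding in1 in2 by auto
  have cover: "in_open_cone ?B1 y \<or> in_open_cone ?B2 y" if "in_open_cone (w, c) y" "off_walls ?B1 y" for y
    using that unfolding in1 in2 inB off1 by auto
  have off: "off_walls ?B1 y \<Longrightarrow> off_walls ?B2 y \<Longrightarrow> off_walls (w, c) y" for y
    unfolding off1 off2 offB by blast
  have h1: "\<forall>i. 0 \<le> h \<bullet> fst ?B1 i" "\<forall>i. 0 \<le> h \<bullet> fst ?B2 i" if "\<forall>i. 0 \<le> h \<bullet> w i" for h
    using nonneg that by auto
  define B1 B2 where "B1 = ?B1" and "B2 = ?B2"
  have "subdivision {B1, B2} (w, c)"
    unfolding subdivision_def
  proof (intro conjI ballI allI impI)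
    fix B' assume "B' \<in> {B1, B2}"
    thus "lattice_cone B'" using cones by (auto simp: B1_def B2_def)
  next
    fix B' h i assume "B' \<in> {B1, B2}" "\<forall>i. 0 \<le> h \<bullet> fst (w, c) i"
    thus "0 \<le> h \<bullet> fst B' i" using h1[of h] unfolding B1_def B2_def by force
  next
    fix y assume y: "\<forall>B'\<in>{B1, B2}. off_walls B' y"
    show "off_walls (w, c) y" using y off[of y] by (simp add: B1_def B2_def)
    show "in_open_cone (w, c) y" if "B' \<in> {B1, B2}" "in_open_cone B' y" for B'
      using that sub1[of y] sub2[of y] unfolding B1_def[symmetric] B2_def[symmetric] by blast
    show "\<exists>!B'\<in>{B1, B2}. in_open_cone B' y" if "in_open_cone (w, c) y"
    proof (cases "in_open_cone B1 y")
      case True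
      hence "\<not> in_open_cone B2 y" using disj[of y] by (simp add: B1_def B2_def)
      thus ?thesis using True by (intro ex1I[of _ B1]) auto
    next
      case False
      hence "in_open_cone B2 y" using cover[OF that] y by (auto simp: B1_def B2_def)
      thus ?thesis using False by (intro ex1I[of _ B2]) auto
    qed
  qed simp
  thus ?thesis unfolding B1_def B2_def .
qed

text \<open>Elliott's reduction: an edge joining generators on opposite sides of the hyperplane is cut
  at its point on the hyperplane, which lowers the number of generators off the hyperplane.\<close>

lemma subdivision_hyperplane:
  fixes B :: "'n::finite framed_cone"
  assumes h: "h \<in> int_lattice" and B: "lattice_cone B"
  shows "\<exists>F. subdivision F B \<and> (\<forall>B'\<in>F. one_sided h B')"
  using B
proof (induction "card {i. h \<bullet> fst B i \<noteq> 0}" arbitrary: B rule: less_induct)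
  case less
  show ?case
  proof (cases "one_sided h B")
    case True
    thus ?thesis using subdivision_refl[OF less.prems] by (intro exI[of _ "{B}"]) auto
  next
    case False
    obtain w c where wc: "B = (w, c)" by (cases B)
    obtain a b where a: "h \<bullet> w a > 0" and b: "h \<bullet> w b < 0"
      using False by (auto simp: one_sided_def wc not_le)
    \<comment> \<open>These weights make the contributions of \<open>w a\<close> and
      \<open>w b\<close> to \<open>h \<bullet> v\<close> cancel. They are integers because
      \<open>h\<close> and the generators are lattice vectors.\<close>
    define p q where "p = - (h \<bullet> w b)" and "q = h \<bullet> w a"
    have ab: "a \<noteq> b" using a b by auto
    have w: "\<And>i. w i \<in> int_lattice" using less.prems by (auto simp: wc lattice_cone_def)
    have pq: "p > 0" "p \<in> \<int>" "q > 0" "q \<in> \<int>"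
      using a b int_lattice_inner[OF h w] by (auto simp: p_def q_def)
    define v where "v = p *\<^sub>R w a + q *\<^sub>R w b"
    define B1 where "B1 = (w(a := v), c(a := (1 / p) *\<^sub>R c a, b := c b - (q / p) *\<^sub>R c a))"
    define B2 where "B2 = (w(b := v), c(b := (1 / q) *\<^sub>R c b, a := c a - (p / q) *\<^sub>R c b))"
    have sub: "subdivision {B1, B2} B"
      unfolding wc B1_def B2_def v_def
      using subdivision_split[OF less.prems[unfolded wc] ab pq] .
    have hv: "h \<bullet> v = 0" unfolding v_def p_def q_def by (simp add: inner_add_right inner_diff_right)
    have c1: "card {i. h \<bullet> fst B1 i \<noteq> 0} < card {i. h \<bullet> fst B i \<noteq> 0}"
    proof (rule psubset_card_mono)
      have "{i. h \<bullet> fst B1 i \<noteq> 0} \<subseteq> {i. h \<bullet> fst B i \<noteq> 0} - {a}"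
        using hv by (auto simp: B1_def wc)
      moreover have "a \<in> {i. h \<bullet> fst B i \<noteq> 0}" using a by (simp add: wc)
      ultimately show "{i. h \<bullet> fst B1 i \<noteq> 0} \<subset> {i. h \<bullet> fst B i \<noteq> 0}" by blast
    qed simp
    have c2: "card {i. h \<bullet> fst B2 i \<noteq> 0} < card {i. h \<bullet> fst B i \<noteq> 0}"
    proof (rule psubset_card_mono)
      have "{i. h \<bullet> fst B2 i \<noteq> 0} \<subseteq> {i. h \<bullet> fst B i \<noteq> 0} - {b}"
        using hv by (auto simp: B2_def wc)
      moreover have "b \<in> {i. h \<bullet> fst B i \<noteq> 0}" using b by (simp add: wc)
      ultimately show "{i. h \<bullet> fst B2 i \<noteq> 0} \<subset> {i. h \<bullet> fst B i \<noteq> 0}" by blast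
    qed simp
    have "\<exists>F. subdivision F B' \<and> (\<forall>C\<in>F. one_sided h C)" if "B' \<in> {B1, B2}" for B'
    proof -
      have "card {i. h \<bullet> fst B' i \<noteq> 0} < card {i. h \<bullet> fst B i \<noteq> 0}" using that c1 c2 by auto
      thus ?thesis using subdivision_lattice_cone[OF sub that] by (rule less.hyps)
    qed
    then obtain G where G: "\<And>B'. B' \<in> {B1, B2} \<Longrightarrow> subdivision (G B') B' \<and> (\<forall>C\<in>G B'. one_sided h C)"
      by metis
    have "subdivision (\<Union>B'\<in>{B1, B2}. G B') B"
      using subdivision_trans[OF sub] G by blast
    thus ?thesis using G by (intro exI[of _ "\<Union>B'\<in>{B1, B2}. G B'"]) blast
  qed
qed

text \<open>Inclusion of cones is applied to both \<open>h\<close> and \<open>-h\<close>. A sign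
  once fixed thus survives every later cut, which lets the hyperplanes be treated one after
  another.\<close>

lemma subdivision_one_sided:
  assumes "subdivision F B" "B' \<in> F" "one_sided h B"
  shows "one_sided h B'"
proof -
  from subdivision_nonneg[OF assms(1,2), of h] subdivision_nonneg[OF assms(1,2), of "-h"]
  show ?thesis using assms(3) by (auto simp: one_sided_def)
qed

lemma subdivision_hyperplanes:
  fixes B :: "'n::finite framed_cone"
  assumes "finite H" "H \<subseteq> int_lattice" and B: "lattice_cone B"
  shows "\<exists>F. subdivision F B \<and> (\<forall>B'\<in>F. \<forall>h\<in>H. one_sided h B')"
  using assms(1,2)
proof (induction H rule: finite_induct)
  case empty
  show ?case using subdivision_refl[OF B] by blast
next
  case (insert h H)
  then obtain F where F: "subdivision F B" "\<forall>B'\<in>F. \<forall>h\<in>H. one_sided h B'" by auto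
  have "\<exists>G. subdivision G B' \<and> (\<forall>C\<in>G. one_sided h C)" if "B' \<in> F" for B'
    using subdivision_lattice_cone[OF F(1) that] insert.prems by (intro subdivision_hyperplane) auto
  then obtain G where G: "\<And>B'. B' \<in> F \<Longrightarrow> subdivision (G B') B' \<and> (\<forall>C\<in>G B'. one_sided h C)"
    by metis
  have "subdivision (\<Union>B'\<in>F. G B') B"
    using subdivision_trans[OF F(1)] G by blast
  moreover have "one_sided k C" if "C \<in> (\<Union>B'\<in>F. G B')" "k \<in> insert h H" for C k
    using that F(2) G subdivision_one_sided by blast
  ultimately show ?case by blast
qed

section \<open>The initial fan of orthants\<close>

definition orthant :: "('n \<Rightarrow> bool) \<Rightarrow> 'n::finite framed_cone" where
  "orthant s = (\<lambda>i. axis i (if s i then 1 else -1), \<lambda>i. axis i (if s i then 1 else -1))"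

lemma lattice_cone_orthant: "lattice_cone (orthant s)"
proof -
  let ?f = "\<lambda>i. axis i (if s i then 1 else -1) :: real ^ 'a"
  have "y = (\<Sum>i\<in>UNIV. (?f i \<bullet> y) *\<^sub>R ?f i)" for y
  proof (subst vec_eq_iff, rule allI)
    fix j
    have f: "?f i \<bullet> y = (if s i then vec_nth y i else - vec_nth y i)" for i
      by (simp add: inner_axis')
    have "vec_nth (\<Sum>i\<in>UNIV. (?f i \<bullet> y) *\<^sub>R ?f i) j = (\<Sum>i\<in>UNIV. if i = j then vec_nth y j else 0)"
      unfolding sum_component f by (intro sum.cong refl) (auto simp: axis_def)
    thus "vec_nth y j = vec_nth (\<Sum>i\<in>UNIV. (?f i \<bullet> y) *\<^sub>R ?f i) j" by simp
  qed
  moreover have "?f i \<bullet> ?f j = (if i = j then 1 else 0)" for i j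
    by (auto simp: inner_axis_axis)
  moreover have "?f i \<in> int_lattice" for i
    by (auto simp: int_lattice_def axis_def)
  ultimately show ?thesis by (simp add: lattice_cone_def orthant_def dual_bases_def)
qed

lemma simplicial_fan_exists:
  assumes "finite H" "H \<subseteq> (int_lattice :: (real ^ 'n) set)"
  shows "\<exists>F :: 'n framed_cone set. finite F \<and> (\<forall>B\<in>F. lattice_cone B \<and> (\<forall>h\<in>H. one_sided h B)) \<and>
     (\<forall>y. (\<forall>B\<in>F. off_walls B y) \<longrightarrow> (\<exists>!B\<in>F. in_open_cone B y))"
proof -
  have "\<exists>F. subdivision F (orthant s) \<and> (\<forall>B\<in>F. \<forall>h\<in>H. one_sided h B)" for s :: "'n \<Rightarrow> bool"
    by (intro subdivision_hyperplanes lattice_cone_orthant assms)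
  then obtain G where G: "\<And>s :: 'n \<Rightarrow> bool. subdivision (G s) (orthant s)"
    and os: "\<And>s B h. B \<in> G s \<Longrightarrow> h \<in> H \<Longrightarrow> one_sided h B" by metis
  have "\<exists>!B\<in>(\<Union>s. G s). in_open_cone B y" if y: "\<forall>B\<in>(\<Union>s. G s). off_walls B y" for y
  proof -
    have Gy: "off_walls (orthant s) y \<and>
        (in_open_cone (orthant s) y \<longrightarrow> (\<exists>!B\<in>G s. in_open_cone B y)) \<and> (\<forall>B\<in>G s. in_open_cone B y \<longrightarrow> in_open_cone (orthant s) y)" for s
      by (rule subdivision_off_walls[OF G[of s]]) (use y in blast)
    have ins: "in_open_cone (orthant s) y \<longleftrightarrow> (\<forall>i. if s i then vec_nth y i > 0 else vec_nth y i < 0)" for s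
      by (simp add: in_open_cone_def orthant_def inner_axis' if_distrib[of "\<lambda>x. x * _"] if_distrib[of "\<lambda>x. 0 < x"] cong: if_cong)
    \<comment> \<open>The coordinate signs single out the orthant. No coordinate vanishes, because
      the walls of any one orthant are already all the coordinate hyperplanes.\<close>
    define s where "s = (\<lambda>i. vec_nth y i > 0)"
    have "vec_nth y i \<noteq> 0" for i
      using Gy[of "\<lambda>_. True"] by (auto simp: off_walls_def orthant_def inner_axis')
    hence s: "in_open_cone (orthant s) y"
      unfolding ins s_def by (metis linorder_neqE_linordered_idom)
    have uni: "s' = s" if "in_open_cone (orthant s') y" for s'
      proof
      fix i
      show "s' i = s i" using that s unfolding ins by (metis not_less_iff_gr_or_eq)
    qed
    obtain B where B: "B \<in> G s" "in_open_cone B y" "\<And>C. C \<in> G s \<Longrightarrow> in_open_cone C y \<Longrightarrow> C = B"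
      using Gy[of s] s by blast
    show ?thesis
      by (rule ex1I[of _ B]) (use B uni Gy in blast)+
  qed
  moreover have "finite (\<Union>s. G s)"
    using G by (intro finite_UN_I) (auto simp: subdivision_def)
  moreover have "\<forall>B\<in>(\<Union>s. G s). lattice_cone B \<and> (\<forall>h\<in>H. one_sided h B)"
    using subdivision_lattice_cone[OF G] os by blast
  ultimately show ?thesis by blast
qed

section \<open>Lattice points of half-open cones\<close>

text \<open>\<open>s i\<close> tells whether the wall where coordinate \<open>i\<close> vanishes is
  included. \<open>S\<close> lists the directions cut off after one unit, to
  [0,1) at an included wall and to (0,1] at an excluded one. Thus \<open>S = {}\<close> gives a
  half-open cone and \<open>S = UNIV\<close> its fundamental parallelepiped.\<close>

definition box_points :: "'n::finite framed_cone \<Rightarrow> ('n \<Rightarrow> bool) \<Rightarrow> 'n set \<Rightarrow> (real ^ 'n) set" where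
  "box_points B s S = {x \<in> int_lattice.
     (\<forall>i. if s i then 0 \<le> snd B i \<bullet> x else 0 < snd B i \<bullet> x) \<and>
     (\<forall>i\<in>S. if s i then snd B i \<bullet> x < 1 else snd B i \<bullet> x \<le> 1)}"

text \<open>The generating function graded by the linear form \<open>u\<close>. As
  \<open>card\<close> of an infinite set is 0, it is meaningful only for finite levels, which
  \<open>finite_level\<close> provides.\<close>

definition level_series :: "real ^ 'n \<Rightarrow> (real ^ 'n) set \<Rightarrow> real fps" where
  "level_series u X = Abs_fps (\<lambda>m. real (card {x \<in> X. u \<bullet> x = real m}))"

lemma dual_bases_inner:
  assumes "dual_bases w c"
  shows "u \<bullet> x = (\<Sum>i\<in>UNIV. (c i \<bullet> x) * (u \<bullet> w i))"
proof -
  have "x = (\<Sum>i\<in>UNIV. (c i \<bullet> x) *\<^sub>R w i)" using assms unfolding dual_bases_def by blast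
  hence "u \<bullet> x = u \<bullet> (\<Sum>i\<in>UNIV. (c i \<bullet> x) *\<^sub>R w i)" by simp
  thus ?thesis by (simp add: inner_sum_right)
qed

locale leveled_cone =
  fixes B :: "'n::finite framed_cone" and u :: "real ^ 'n" and N :: nat
  assumes cone: "lattice_cone B" and level: "\<And>i. u \<bullet> fst B i = real N" and N_pos: "N > 0"
begin

lemma coord_gen: "snd B i \<bullet> fst B j = (if i = j then 1 else 0)"
  using cone unfolding lattice_cone_def dual_bases_def by blast

lemma level_eq: "u \<bullet> x = real N * (\<Sum>i\<in>UNIV. snd B i \<bullet> x)"
proof -
  have "dual_bases (fst B) (snd B)" using cone by (simp add: lattice_cone_def)
  from dual_bases_inner[OF this, of u x] show ?thesis
    by (simp add: level sum_distrib_left mult.commute)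
qed

lemma gen_lattice: "fst B i \<in> int_lattice"
  using cone unfolding lattice_cone_def by blast

lemma box_points_nonneg: "x \<in> box_points B s S \<Longrightarrow> 0 \<le> snd B i \<bullet> x"
  unfolding box_points_def by (smt (verit) mem_Collect_eq)

text \<open>The coordinates are nonnegative with sum \<open>r / N\<close>, so the level is
  bounded.\<close>

lemma finite_level: "finite {x \<in> box_points B s S. u \<bullet> x = r}"
proof -
  have "norm x \<le> (\<Sum>i\<in>UNIV. (r / N) * norm (fst B i))"
    if x: "x \<in> box_points B s S" "u \<bullet> x = r" for x
  proof -
    have nn: "0 \<le> snd B i \<bullet> x" for i by (rule box_points_nonneg[OF x(1)])
    have le: "snd B i \<bullet> x \<le> r / N" for i
    proof -
      have "snd B i \<bullet> x \<le> (\<Sum>i\<in>UNIV. snd B i \<bullet> x)"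
        by (rule member_le_sum) (use nn in auto)
      hence "real N * (snd B i \<bullet> x) \<le> r" using x(2) unfolding level_eq by (metis mult_left_mono of_nat_0_le_iff)
      thus ?thesis using N_pos by (simp add: field_simps)
    qed
    have "x = (\<Sum>i\<in>UNIV. (snd B i \<bullet> x) *\<^sub>R fst B i)"
      using cone unfolding lattice_cone_def dual_bases_def by blast
    hence "norm x = norm (\<Sum>i\<in>UNIV. (snd B i \<bullet> x) *\<^sub>R fst B i)" by simp
    also have "\<dots> \<le> (\<Sum>i\<in>UNIV. (r / N) * norm (fst B i))"
    proof (rule sum_norm_le)
      fix i show "norm ((snd B i \<bullet> x) *\<^sub>R fst B i) \<le> (r / N) * norm (fst B i)"
        using nn[of i] mult_right_mono[OF le[of i] norm_ge_zero] by simp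
    qed
    finally show ?thesis .
  qed
  hence "bounded {x \<in> box_points B s S. u \<bullet> x = r}"
    by (intro boundedI[of _ "\<Sum>i\<in>UNIV. (r / N) * norm (fst B i)"]) simp
  from finite_bounded_int_lattice[OF this]
  show ?thesis by (rule rev_finite_subset) (auto simp: box_points_def)
qed

text \<open>Points beyond the cut in direction \<open>i\<close> are translates by the
  \<open>i\<close>-th generator of points lying \<open>N\<close> levels lower. The half-open
  convention makes this exact: [0,1) removed from the closed half-line, or (0,1] removed from the
  open one, leaves its unit translate.\<close>

lemma card_level_insert:
  assumes "i \<notin> S"
  shows "card {x \<in> box_points B s S. u \<bullet> x = r} =
    card {x \<in> box_points B s (insert i S). u \<bullet> x = r} + card {x \<in> box_points B s S. u \<bullet> x = r - N}"
proof -
  let ?w = "fst B i"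
  let ?T = "(\<lambda>x. x + ?w) ` {x \<in> box_points B s S. u \<bullet> x = r - N}"
  have T: "x \<in> ?T \<longleftrightarrow> x - ?w \<in> box_points B s S \<and> u \<bullet> x = r" for x
  proof
    assume "x \<in> ?T"
    thus "x - ?w \<in> box_points B s S \<and> u \<bullet> x = r" by (auto simp: inner_add_right level)
  next
    assume "x - ?w \<in> box_points B s S \<and> u \<bullet> x = r"
    thus "x \<in> ?T" by (intro image_eqI[of _ _ "x - ?w"]) (auto simp: inner_diff_right level)
  qed
  have lat: "x - ?w \<in> int_lattice \<longleftrightarrow> x \<in> int_lattice" for x
    using int_lattice_add[of "x - ?w" ?w] int_lattice_diff[of x ?w] gen_lattice[of i] by auto
  have co': "snd B j \<bullet> (x - ?w) = snd B j \<bullet> x - (if j = i then 1 else 0)" for x j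
    by (simp add: inner_diff_right coord_gen)
  have shift: "x - ?w \<in> box_points B s S \<longleftrightarrow>
      x \<in> box_points B s S \<and> \<not> (if s i then snd B i \<bullet> x < 1 else snd B i \<bullet> x \<le> 1)" for x
  proof -
    have *: "(if s j then 0 \<le> snd B j \<bullet> (x - ?w) else 0 < snd B j \<bullet> (x - ?w)) \<longleftrightarrow>
       (if s j then 0 \<le> snd B j \<bullet> x else 0 < snd B j \<bullet> x) \<and>
       (j = i \<longrightarrow> \<not> (if s i then snd B i \<bullet> x < 1 else snd B i \<bullet> x \<le> 1))" for j
      unfolding co' by auto
    have **: "(if s j then snd B j \<bullet> (x - ?w) < 1 else snd B j \<bullet> (x - ?w) \<le> 1) \<longleftrightarrow>
       (if s j then snd B j \<bullet> x < 1 else snd B j \<bullet> x \<le> 1)" if "j \<in> S" for j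
      unfolding co' using that assms by auto
    show ?thesis unfolding box_points_def mem_Collect_eq lat * using ** by blast
  qed
  have ins: "x \<in> box_points B s (insert i S) \<longleftrightarrow>
      x \<in> box_points B s S \<and> (if s i then snd B i \<bullet> x < 1 else snd B i \<bullet> x \<le> 1)" for x
    unfolding box_points_def by blast
  have un: "{x \<in> box_points B s S. u \<bullet> x = r} = {x \<in> box_points B s (insert i S). u \<bullet> x = r} \<union> ?T"
    by (rule set_eqI) (unfold Un_iff T shift ins mem_Collect_eq, blast)
  have disj: "{x \<in> box_points B s (insert i S). u \<bullet> x = r} \<inter> ?T = {}"
    by (rule set_eqI) (unfold Int_iff T shift ins mem_Collect_eq, blast)
  have T: "card ?T = card {x \<in> box_points B s S. u \<bullet> x = r - N}"
    by (rule card_image) simp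
  show ?thesis
    unfolding un card_Un_disjoint[OF finite_level finite_imageI[OF finite_level] disj] T ..
qed

lemma level_series_insert:
  assumes "i \<notin> S"
  shows "level_series u (box_points B s S) * (1 - fps_X ^ N) = level_series u (box_points B s (insert i S))"
proof (rule fps_ext)
  fix m
  let ?a = "\<lambda>r. real (card {x \<in> box_points B s S. u \<bullet> x = r})"
  have "fps_nth (level_series u (box_points B s S) * (1 - fps_X ^ N)) m
      = ?a m - (if m < N then 0 else ?a (real (m - N)))"
    by (simp add: right_diff_distrib fps_X_power_mult_right_nth level_series_def)
  \<comment> \<open>For \<open>m < N\<close> the shifted level is negative; no point lies there, so
    the count agrees with the guard.\<close>
  also have "(if m < N then 0 else ?a (real (m - N))) = ?a (real m - real N)"
  proof (cases "m < N")
    case True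
    have "u \<bullet> x \<noteq> real m - real N" if "x \<in> box_points B s S" for x
    proof -
      have "0 \<le> u \<bullet> x"
        unfolding level_eq by (intro mult_nonneg_nonneg sum_nonneg box_points_nonneg[OF that]) auto
      thus ?thesis using True by simp
    qed
    hence "{x \<in> box_points B s S. u \<bullet> x = real m - real N} = {}" by blast
    hence "?a (real m - real N) = 0" by (metis card.empty of_nat_0)
    thus ?thesis using True by simp
  qed (simp add: of_nat_diff)
  finally show "fps_nth (level_series u (box_points B s S) * (1 - fps_X ^ N)) m =
      fps_nth (level_series u (box_points B s (insert i S))) m"
    using card_level_insert[OF assms, of s "real m"] by (simp add: level_series_def)
qed

lemma level_series_parallelepiped:
  "level_series u (box_points B s {}) * (1 - fps_X ^ N) ^ CARD('n) = level_series u (box_points B s UNIV)"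
proof -
  have "level_series u (box_points B s {}) * (1 - fps_X ^ N) ^ card S = level_series u (box_points B s S)" for S
  proof (induction S rule: finite_induct[OF finite])
    case (2 i S)
    thus ?case using level_series_insert[of i S s] by (simp add: mult_ac)
  qed simp
  thus ?thesis .
qed

text \<open>Subtraction from the sum of all generators sends a coordinate z to 1 - z. This exchanges
  [0,1) with (0,1], hence negates \<open>s\<close>, and reflects the levels.\<close>

lemma card_level_reflect:
  "card {x \<in> box_points B s UNIV. u \<bullet> x = r} =
   card {x \<in> box_points B (\<lambda>i. \<not> s i) UNIV. u \<bullet> x = real (CARD('n) * N) - r}"
proof -
  define v where "v = (\<Sum>i\<in>UNIV. fst B i)"
  have cv: "snd B i \<bullet> (v - x) = 1 - snd B i \<bullet> x" for i x
    by (simp add: v_def inner_diff_right inner_sum_right coord_gen)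
  have uv: "u \<bullet> (v - x) = real (CARD('n) * N) - u \<bullet> x" for x
    by (simp add: v_def inner_diff_right inner_sum_right level)
  have lat: "v - x \<in> int_lattice" if "x \<in> int_lattice" for x
    unfolding v_def using that by (intro int_lattice_diff int_lattice_sum gen_lattice)
  have mem: "v - x \<in> box_points B (\<lambda>i. \<not> s i) UNIV" if "x \<in> box_points B s UNIV" for x s
    using that lat unfolding box_points_def by (simp add: cv)
  have mem': "v - x \<in> box_points B s UNIV" if "x \<in> box_points B (\<lambda>i. \<not> s i) UNIV" for x
    using mem[OF that] by simp
  have "bij_betw (\<lambda>x. v - x) {x \<in> box_points B s UNIV. u \<bullet> x = r}
     {x \<in> box_points B (\<lambda>i. \<not> s i) UNIV. u \<bullet> x = real (CARD('n) * N) - r}"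
    by (rule bij_betw_byWitness[where f' = "\<lambda>x. v - x"]) (use mem mem' uv in auto)
  thus ?thesis by (rule bij_betw_same_card)
qed

lemma card_level_eq_0:
  assumes "r > CARD('n) * N"
  shows "card {x \<in> box_points B s UNIV. u \<bullet> x = real r} = 0"
proof -
  have "u \<bullet> x \<noteq> r" if "x \<in> box_points B s UNIV" for x
  proof -
    have "snd B i \<bullet> x \<le> 1" for i
      using that unfolding box_points_def by (smt (verit) mem_Collect_eq UNIV_I)
    hence "(\<Sum>i\<in>UNIV. snd B i \<bullet> x) \<le> (\<Sum>i\<in>(UNIV::'n set). 1)" by (intro sum_mono)
    hence "real N * (\<Sum>i\<in>UNIV. snd B i \<bullet> x) \<le> real N * CARD('n)" by (intro mult_left_mono) auto
    also have "\<dots> = real (CARD('n) * N)" by simp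
    also have "\<dots> < real r" using assms by (simp only: of_nat_less_iff)
    finally show ?thesis by (simp add: level_eq)
  qed
  thus ?thesis by (metis (mono_tags, lifting) card.empty empty_Collect_eq)
qed

end

section \<open>Generic directions and half-open partitions\<close>

lemma exists_off_hyperplanes:
  fixes C :: "'a::euclidean_space set"
  assumes "finite C" "0 \<notin> C"
  shows "\<exists>\<xi>. \<forall>c\<in>C. c \<bullet> \<xi> \<noteq> 0"
proof -
  have "negligible (\<Union>c\<in>C. {x. c \<bullet> x = 0})"
    using assms by (intro negligible_Union finite_imageI) (auto intro!: negligible_hyperplane)
  hence "(\<Union>c\<in>C. {x. c \<bullet> x = 0}) \<noteq> UNIV" using non_negligible_UNIV by metis
  thus ?thesis by blast
qed

text \<open>Every point \<open>x\<close> is assigned to the open cone containing \<open>x + \<epsilon> \<xi>\<close> for small \<open>\<epsilon> > 0\<close>.\<close>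

lemma half_open_partition:
  assumes F: "finite F" "\<And>y. (\<forall>B\<in>F. off_walls B y) \<Longrightarrow> \<exists>!B\<in>F. in_open_cone B y"
    and \<xi>: "\<forall>B\<in>F. off_walls B \<xi>" and x: "x \<in> int_lattice"
  shows "\<exists>!B\<in>F. x \<in> box_points B (\<lambda>i. snd B i \<bullet> \<xi> > 0) {}"
proof -
  \<comment> \<open>\<open>?good\<close> asks that the perturbed point avoid the wall of
    \<open>c\<close> and lie on its positive side exactly when the half-open rule accepts
    \<open>x\<close>.\<close>
  let ?good = "\<lambda>\<epsilon> c. c \<bullet> (x + \<epsilon> *\<^sub>R \<xi>) \<noteq> 0 \<and>
     (0 < c \<bullet> (x + \<epsilon> *\<^sub>R \<xi>) \<longleftrightarrow> (if 0 < c \<bullet> \<xi> then 0 \<le> c \<bullet> x else 0 < c \<bullet> x))"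
  have ev: "eventually (\<lambda>\<epsilon>. ?good \<epsilon> c) (at_right 0)" if c: "c \<bullet> \<xi> \<noteq> 0" for c
  proof -
    have lim: "((\<lambda>\<epsilon>. c \<bullet> (x + \<epsilon> *\<^sub>R \<xi>)) \<longlongrightarrow> c \<bullet> (x + 0 *\<^sub>R \<xi>)) (at_right 0)"
      by (intro tendsto_intros)
    \<comment> \<open>A nonzero value at \<open>x\<close> keeps its sign by continuity; a zero value
      takes the sign of \<open>c \<bullet> \<xi>\<close>.\<close>
    consider "c \<bullet> x > 0" | "c \<bullet> x < 0" | "c \<bullet> x = 0" by linarith
    thus ?thesis
    proof cases
      case 1
      hence "eventually (\<lambda>\<epsilon>. 0 < c \<bullet> (x + \<epsilon> *\<^sub>R \<xi>)) (at_right 0)"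
        by (intro order_tendstoD(1)[OF lim]) simp
      thus ?thesis by eventually_elim (use 1 in auto)
    next
      case 2
      hence "eventually (\<lambda>\<epsilon>. c \<bullet> (x + \<epsilon> *\<^sub>R \<xi>) < 0) (at_right 0)"
        by (intro order_tendstoD(2)[OF lim]) simp
      thus ?thesis by eventually_elim (use 2 in auto)
    next
      case 3
      have "eventually (\<lambda>\<epsilon>. \<epsilon> > (0::real)) (at_right 0)" by (rule eventually_at_right_less)
      thus ?thesis
        by eventually_elim (use 3 c in \<open>auto simp: inner_add_right zero_less_mult_iff\<close>)
    qed
  qed
  have "eventually (\<lambda>\<epsilon>. \<forall>B\<in>F. \<forall>i\<in>UNIV. ?good \<epsilon> (snd B i)) (at_right 0)"
    using \<xi> by (intro eventually_ball_finite F(1) ballI ev) (auto simp: off_walls_def)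
  then obtain \<epsilon> where \<epsilon>: "\<forall>B\<in>F. \<forall>i\<in>UNIV. ?good \<epsilon> (snd B i)"
    using eventually_happens trivial_limit_at_right_real by blast
  define y where "y = x + \<epsilon> *\<^sub>R \<xi>"
  have "off_walls B y" if "B \<in> F" for B using \<epsilon> that by (auto simp: off_walls_def y_def)
  hence ex: "\<exists>!B\<in>F. in_open_cone B y" using F(2) by blast
  have "in_open_cone B y \<longleftrightarrow> x \<in> box_points B (\<lambda>i. snd B i \<bullet> \<xi> > 0) {}" if "B \<in> F" for B
    using \<epsilon>[rule_format, OF that UNIV_I] x unfolding in_open_cone_def box_points_def y_def by simp
  hence "(B \<in> F \<and> in_open_cone B y) = (B \<in> F \<and> x \<in> box_points B (\<lambda>i. snd B i \<bullet> \<xi> > 0) {})" for B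
    by blast
  thus ?thesis using ex by simp
qed

section \<open>The gauge series\<close>

text \<open>The counted set is level \<open>m\<close> of the gauge. By \<open>pos\<close> the gauge
  is positive off the origin, so every generator of the fan has positive level and a denominator of
  this form arises.\<close>

lemma gauge_series_palindromic:
  fixes V :: "(real ^ 'n) set"
  assumes V: "finite V" "V \<noteq> {}" "V \<subseteq> int_lattice"
    and pos: "\<And>x. x \<noteq> 0 \<Longrightarrow> \<exists>u\<in>V. u \<bullet> x > 0"
  shows "\<exists>N q. 0 < N \<and> (\<forall>m\<le>CARD('n) * N. q m = q (CARD('n) * N - m)) \<and> (\<forall>m>CARD('n) * N. q m = 0) \<and>
    Abs_fps (\<lambda>m. real (card {x \<in> int_lattice. (\<forall>u\<in>V. u \<bullet> x \<le> real m) \<and> (\<exists>u\<in>V. u \<bullet> x = real m)})) *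
      (1 - fps_X ^ N) ^ CARD('n) = Abs_fps q"
proof -
  \<comment> \<open>On these hyperplanes two forms of \<open>V\<close> tie, so on a cone that is
    one-sided for all of them any two forms are comparable.\<close>
  define H where "H = (\<lambda>(u, v). u - v) ` (V \<times> V)"
  have H: "finite H" "H \<subseteq> int_lattice"
    using V by (auto simp: H_def intro: int_lattice_diff)
  obtain F :: "'n framed_cone set" where F: "finite F" "\<And>B. B \<in> F \<Longrightarrow> lattice_cone B"
    "\<And>B h. B \<in> F \<Longrightarrow> h \<in> H \<Longrightarrow> one_sided h B"
    "\<And>y. (\<forall>B\<in>F. off_walls B y) \<Longrightarrow> \<exists>!B\<in>F. in_open_cone B y"
    using simplicial_fan_exists[OF H] by metis
  have gen: "snd B i \<bullet> fst B j = (if i = j then 1 else 0)" if "B \<in> F" for B i j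
    using F(2)[OF that] unfolding lattice_cone_def dual_bases_def by blast
  have "\<exists>u\<in>V. \<forall>v\<in>V. \<forall>i. v \<bullet> fst B i \<le> u \<bullet> fst B i" if B: "B \<in> F" for B
  proof -
    \<comment> \<open>The sum of the generators is interior to the cone; a form of \<open>V\<close>
      that is maximal there turns out to be maximal at every generator.\<close>
    let ?f = "\<lambda>v. v \<bullet> (\<Sum>i\<in>UNIV. fst B i)"
    obtain u where u: "u \<in> V" "\<And>v. v \<in> V \<Longrightarrow> ?f v \<le> ?f u"
      using obtains_MAX[OF V(1,2), of ?f] Max_ge[of "?f ` V"] V(1) by (metis finite_imageI imageI)
    have "v \<bullet> fst B i \<le> u \<bullet> fst B i" if v: "v \<in> V" for v i
    proof (cases "\<forall>i. 0 \<le> (u - v) \<bullet> fst B i")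
      case True
      thus ?thesis by (simp add: inner_diff_left)
    next
      case False
      moreover have "one_sided (u - v) B"
        using F(3)[OF B, of "u - v"] u(1) v by (auto simp: H_def)
      ultimately have le: "\<And>i. (u - v) \<bullet> fst B i \<le> 0" unfolding one_sided_def by blast
      \<comment> \<open>The summands are nonnegative, while maximality of \<open>u\<close> makes
        their sum nonpositive; so \<open>u\<close> and \<open>v\<close> tie at every
        generator.\<close>
      have "(\<Sum>i\<in>UNIV. - ((u - v) \<bullet> fst B i)) \<le> 0"
        using u(2)[OF v] by (simp add: inner_sum_right inner_diff_left sum_negf sum_subtractf)
      moreover have "(\<Sum>i\<in>UNIV. - ((u - v) \<bullet> fst B i)) \<ge> 0" using le by (intro sum_nonneg) simp
      ultimately have "(\<Sum>i\<in>UNIV. - ((u - v) \<bullet> fst B i)) = 0" by linarith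
      hence "- ((u - v) \<bullet> fst B i) = 0"
        using le by (subst (asm) sum_nonneg_eq_0_iff) auto
      thus ?thesis by (simp add: inner_diff_left)
    qed
    thus ?thesis using u(1) by blast
  qed
  then obtain U where U: "\<And>B. B \<in> F \<Longrightarrow> U B \<in> V"
    "\<And>B v i. B \<in> F \<Longrightarrow> v \<in> V \<Longrightarrow> v \<bullet> fst B i \<le> U B \<bullet> fst B i"
    by metis
  have Upos: "U B \<bullet> fst B i > 0" if B: "B \<in> F" for B i
  proof -
    have "fst B i \<noteq> 0" using gen[OF B, of i i] by auto
    from pos[OF this] obtain v where "v \<in> V" "v \<bullet> fst B i > 0" by blast
    thus ?thesis using U(2)[OF B, of v i] by linarith
  qed
  define a where "a = (\<lambda>B i. nat \<lfloor>U B \<bullet> fst B i\<rfloor>)"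
  have a: "U B \<bullet> fst B i = real (a B i)" "a B i > 0" if B: "B \<in> F" for B i
  proof -
    have "U B \<bullet> fst B i \<in> \<int>"
      using int_lattice_inner U(1)[OF B] V(3) F(2)[OF B] unfolding lattice_cone_def by blast
    then obtain z where z: "U B \<bullet> fst B i = of_int z" by (auto elim: Ints_cases)
    show "U B \<bullet> fst B i = real (a B i)" "a B i > 0"
      using Upos[OF B, of i] by (auto simp: a_def z)
  qed
  \<comment> \<open>A common multiple of all levels, so that \<open>N / a B i\<close> is an
    integer.\<close>
  define N where "N = (\<Prod>B\<in>F. \<Prod>i\<in>UNIV. a B i)"
  have N: "N > 0" unfolding N_def using a by (intro prod_pos) auto
  have advd: "a B i dvd N" if B: "B \<in> F" for B i
  proof -
    have "a B i dvd (\<Prod>i\<in>UNIV. a B i)" by (rule dvd_prodI) auto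
    also have "\<dots> dvd N" unfolding N_def by (rule dvd_prodI[OF F(1) B])
    finally show ?thesis .
  qed
  \<comment> \<open>rescaling the generators so that each has level \<open>N\<close> gives all cones the same denominator\<close>
  define T where "T = (\<lambda>B. (\<lambda>i. (real N / a B i) *\<^sub>R fst B i, \<lambda>i. (a B i / real N) *\<^sub>R snd B i))"
  have T: "leveled_cone (T B) (U B) N" if B: "B \<in> F" for B
  proof
    have "y = (\<Sum>i\<in>UNIV. (snd (T B) i \<bullet> y) *\<^sub>R fst (T B) i)" for y
    proof -
      have "(\<Sum>i\<in>UNIV. (snd (T B) i \<bullet> y) *\<^sub>R fst (T B) i) = (\<Sum>i\<in>UNIV. (snd B i \<bullet> y) *\<^sub>R fst B i)"
        using a(2)[OF B] N by (intro sum.cong refl) (simp add: T_def less_imp_neq[symmetric])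
      also have "\<dots> = y" using F(2)[OF B] unfolding lattice_cone_def dual_bases_def by metis
      finally show ?thesis by simp
    qed
    moreover have "snd (T B) i \<bullet> fst (T B) j = (if i = j then 1 else 0)" for i j
      using a(2)[OF B, of i] N gen[OF B, of i j] by (auto simp: T_def)
    moreover have "fst (T B) i \<in> int_lattice" for i
    proof -
      obtain d where "N = a B i * d" using advd[OF B] by (auto elim: dvdE)
      hence "real N / a B i = real d" using a(2)[OF B, of i] by simp
      moreover have "fst B i \<in> int_lattice" using F(2)[OF B] unfolding lattice_cone_def by blast
      ultimately show ?thesis by (simp add: T_def int_lattice_scaleR)
    qed
    ultimately show "lattice_cone (T B)" unfolding lattice_cone_def dual_bases_def by blast
    show "U B \<bullet> fst (T B) i = real N" for i
      using a[OF B, of i] by (simp add: T_def)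
    show "N > 0" by (rule N)
  qed
  \<comment> \<open>Positive rescaling preserves the half-open cone; only its parallelepiped depends
    on the scale.\<close>
  have boxT: "box_points (T B) s {} = box_points B s {}" if B: "B \<in> F" for B s
  proof -
    have aux: "(0 \<le> p * y \<longleftrightarrow> 0 \<le> y) \<and> (0 < p * y \<longleftrightarrow> 0 < y)" if "p > 0" for p y :: real
      using that by (simp add: zero_le_mult_iff zero_less_mult_iff)
    have p: "0 < real (a B i) / real N" for i using a(2)[OF B] N by simp
    have "snd (T B) i \<bullet> x = (real (a B i) / real N) * (snd B i \<bullet> x)" for i x by (simp add: T_def)
    hence "0 \<le> snd (T B) i \<bullet> x \<longleftrightarrow> 0 \<le> snd B i \<bullet> x" "0 < snd (T B) i \<bullet> x \<longleftrightarrow> 0 < snd B i \<bullet> x" for i x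
      using aux[OF p[of i], of "snd B i \<bullet> x"] by simp_all
    thus ?thesis unfolding box_points_def by simp
  qed
  \<comment> \<open>Coordinates of points in the cone are nonnegative, so \<open>U B\<close>,
    maximal at the generators, is maximal at all these points.\<close>
  have gauge: "(\<forall>u\<in>V. u \<bullet> x \<le> r) \<and> (\<exists>u\<in>V. u \<bullet> x = r) \<longleftrightarrow> U B \<bullet> x = r"
    if B: "B \<in> F" and x: "x \<in> box_points B s {}" for B s x r
  proof -
    have nn: "0 \<le> snd B i \<bullet> x" for i
      using x unfolding box_points_def by (smt (verit) mem_Collect_eq)
    have D: "dual_bases (fst B) (snd B)" using F(2)[OF B] by (simp add: lattice_cone_def)
    have "v \<bullet> x \<le> U B \<bullet> x" if "v \<in> V" for v
    proof -
      have "v \<bullet> x = (\<Sum>i\<in>UNIV. (snd B i \<bullet> x) * (v \<bullet> fst B i))" by (rule dual_bases_inner[OF D])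
      also have "\<dots> \<le> (\<Sum>i\<in>UNIV. (snd B i \<bullet> x) * (U B \<bullet> fst B i))"
        by (intro sum_mono mult_left_mono U(2)[OF B that] nn)
      also have "\<dots> = U B \<bullet> x" by (rule dual_bases_inner[OF D, symmetric])
      finally show ?thesis .
    qed
    thus ?thesis using U(1)[OF B] by force
  qed
  let ?Z = "\<lambda>m. {x \<in> int_lattice. (\<forall>u\<in>V. u \<bullet> x \<le> real m) \<and> (\<exists>u\<in>V. u \<bullet> x = real m)}"
  \<comment> \<open>The left side does not involve \<open>\<xi>\<close>, so all generic directions
    yield the same sum.\<close>
  have series: "Abs_fps (\<lambda>m. real (card (?Z m))) * (1 - fps_X ^ N) ^ CARD('n) =
      (\<Sum>B\<in>F. level_series (U B) (box_points (T B) (\<lambda>i. snd B i \<bullet> \<xi> > 0) UNIV))"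
    if \<xi>: "\<forall>B\<in>F. off_walls B \<xi>" for \<xi>
  proof -
    let ?K = "\<lambda>B. box_points B (\<lambda>i. snd B i \<bullet> \<xi> > 0) {}"
    have part: "\<exists>!B\<in>F. x \<in> ?K B" if "x \<in> int_lattice" for x
      using half_open_partition[OF F(1,4) \<xi> that] .
    have sub: "?K B \<subseteq> int_lattice" for B unfolding box_points_def by blast
    have "card (?Z m) = (\<Sum>B\<in>F. card {x \<in> ?K B. U B \<bullet> x = real m})" for m
    proof -
      have "?Z m = (\<Union>B\<in>F. {x \<in> ?K B. U B \<bullet> x = real m})"
      proof (intro set_eqI iffI)
        fix x assume x: "x \<in> ?Z m"
        then obtain B where "B \<in> F" "x \<in> ?K B" using part[of x] by blast
        thus "x \<in> (\<Union>B\<in>F. {x \<in> ?K B. U B \<bullet> x = real m})" using gauge x by blast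
      next
        fix x assume "x \<in> (\<Union>B\<in>F. {x \<in> ?K B. U B \<bullet> x = real m})"
        then obtain B where B: "B \<in> F" "x \<in> ?K B" "U B \<bullet> x = real m" by blast
        show "x \<in> ?Z m" using gauge[OF B(1,2), of "real m"] B(3) sub B(2) by blast
      qed
      moreover have "card (\<Union>B\<in>F. {x \<in> ?K B. U B \<bullet> x = real m}) = (\<Sum>B\<in>F. card {x \<in> ?K B. U B \<bullet> x = real m})"
      proof (rule card_UN_disjoint[OF F(1)])
        show "\<forall>B\<in>F. finite {x \<in> ?K B. U B \<bullet> x = real m}"
          using leveled_cone.finite_level[OF T] boxT by metis
        show "\<forall>B\<in>F. \<forall>C\<in>F. B \<noteq> C \<longrightarrow> {x \<in> ?K B. U B \<bullet> x = real m} \<inter> {x \<in> ?K C. U C \<bullet> x = real m} = {}"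
        proof (intro ballI impI)
          fix B C assume BC: "B \<in> F" "C \<in> F" "B \<noteq> C"
          have "\<not> (x \<in> ?K B \<and> x \<in> ?K C)" for x
            using part[of x] sub[of B] BC by blast
          thus "{x \<in> ?K B. U B \<bullet> x = real m} \<inter> {x \<in> ?K C. U C \<bullet> x = real m} = {}" by blast
        qed
      qed
      ultimately show ?thesis by simp
    qed
    hence "Abs_fps (\<lambda>m. real (card (?Z m))) = (\<Sum>B\<in>F. level_series (U B) (?K B))"
      by (intro fps_ext) (simp add: fps_sum_nth level_series_def)
    also have "\<dots> * (1 - fps_X ^ N) ^ CARD('n) =
        (\<Sum>B\<in>F. level_series (U B) (box_points (T B) (\<lambda>i. snd B i \<bullet> \<xi> > 0) UNIV))"
      unfolding sum_distrib_right
    proof (rule sum.cong[OF refl])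
      fix B assume B: "B \<in> F"
      show "level_series (U B) (?K B) * (1 - fps_X ^ N) ^ CARD('n) =
          level_series (U B) (box_points (T B) (\<lambda>i. snd B i \<bullet> \<xi> > 0) UNIV)"
        using leveled_cone.level_series_parallelepiped[OF T[OF B]] boxT[OF B] by simp
    qed
    finally show ?thesis .
  qed
  have "0 \<notin> (\<Union>B\<in>F. range (snd B))"
  proof
    assume "0 \<in> (\<Union>B\<in>F. range (snd B))"
    then obtain B i where "B \<in> F" "snd B i = 0" by auto
    thus False using gen[of B i i] by simp
  qed
  then obtain \<xi> where "\<forall>c\<in>(\<Union>B\<in>F. range (snd B)). c \<bullet> \<xi> \<noteq> 0"
    using exists_off_hyperplanes[of "\<Union>B\<in>F. range (snd B)"] F(1) by auto
  hence \<xi>: "\<forall>B\<in>F. off_walls B \<xi>" by (auto simp: off_walls_def)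
  hence \<xi>': "\<forall>B\<in>F. off_walls B (- \<xi>)" by (auto simp: off_walls_def)
  let ?s = "\<lambda>B i. snd B i \<bullet> \<xi> > 0"
  \<comment> \<open>No dual vector vanishes at \<open>\<xi>\<close>, so reversing the direction
    swaps included and excluded walls throughout.\<close>
  have neg: "(\<lambda>i. snd B i \<bullet> (- \<xi>) > 0) = (\<lambda>i. \<not> ?s B i)" if "B \<in> F" for B
  proof
    fix i
    have "snd B i \<bullet> \<xi> \<noteq> 0" using \<xi> that unfolding off_walls_def by blast
    thus "(snd B i \<bullet> (- \<xi>) > 0) = (\<not> ?s B i)" by auto
  qed
  define q where "q m = fps_nth (\<Sum>B\<in>F. level_series (U B) (box_points (T B) (?s B) UNIV)) m" for m
  have q: "q m = (\<Sum>B\<in>F. real (card {x \<in> box_points (T B) (?s B) UNIV. U B \<bullet> x = real m}))" for m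
    by (simp add: q_def fps_sum_nth level_series_def)
  have "q m = fps_nth (\<Sum>B\<in>F. level_series (U B) (box_points (T B) (\<lambda>i. snd B i \<bullet> (- \<xi>) > 0) UNIV)) m" for m
    unfolding q_def series[OF \<xi>, symmetric] series[OF \<xi>', symmetric] ..
  hence q': "q m = (\<Sum>B\<in>F. real (card {x \<in> box_points (T B) (\<lambda>i. \<not> ?s B i) UNIV. U B \<bullet> x = real m}))" for m
    unfolding fps_sum_nth level_series_def fps_nth_Abs_fps
    by (rule trans) (intro sum.cong refl, simp only: neg)
  have "q m = q (CARD('n) * N - m)" if m: "m \<le> CARD('n) * N" for m
    unfolding q[of m] q'[of "CARD('n) * N - m"]
  proof (rule sum.cong[OF refl])
    fix B assume B: "B \<in> F"
    show "real (card {x \<in> box_points (T B) (?s B) UNIV. U B \<bullet> x = real m}) =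
        real (card {x \<in> box_points (T B) (\<lambda>i. \<not> ?s B i) UNIV. U B \<bullet> x = real (CARD('n) * N - m)})"
      unfolding of_nat_diff[OF m]
      using leveled_cone.card_level_reflect[OF T[OF B], of "?s B" "real m"] by simp
  qed
  moreover have "q m = 0" if "m > CARD('n) * N" for m
    unfolding q using leveled_cone.card_level_eq_0[OF T that] by (intro sum.neutral) simp
  moreover have "Abs_fps (\<lambda>m. real (card (?Z m))) * (1 - fps_X ^ N) ^ CARD('n) = Abs_fps q"
    unfolding series[OF \<xi>] by (rule fps_ext) (simp add: q_def)
  ultimately show ?thesis using N by (intro exI[of _ N] exI[of _ q]) blast
qed

section \<open>Palindromic numerators\<close>

lemma sum_power_reflect:
  fixes f :: "nat \<Rightarrow> real"
  assumes "t \<noteq> 0"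
  shows "t ^ d * (\<Sum>j\<le>d. f j * (1 / t) ^ j) = (\<Sum>j\<le>d. f (d - j) * t ^ j)"
proof -
  have "t ^ d * (\<Sum>j\<le>d. f j * (1 / t) ^ j) = (\<Sum>j\<le>d. f j * t ^ (d - j))"
    unfolding sum_distrib_left
    using assms by (intro sum.cong refl) (simp add: power_diff power_one_over)
  also have "\<dots> = (\<Sum>j\<le>d. f (d - j) * t ^ j)"
    using sum.nat_diff_reindex[of "\<lambda>j. f j * t ^ (d - j)" "Suc d"]
    by (simp add: lessThan_Suc_atMost)
  finally show ?thesis .
qed

lemma fps_of_poly_sum_monom:
  fixes f :: "nat \<Rightarrow> real"
  assumes "\<And>m. m > d \<Longrightarrow> f m = 0"
  shows "fps_of_poly (\<Sum>j\<le>d. monom (f j) j) = Abs_fps f"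
  using assms by (intro fps_ext) (simp add: coeff_sum)

text \<open>Substitute \<open>1 / t\<close> in the identity of polynomials and multiply by
  \<open>t ^ (n * N + d + 1)\<close>. The palindromic \<open>q\<close> returns to itself and
  \<open>f\<close> is reversed. The hypothesis on \<open>d\<close> makes the powers of
  \<open>t\<close> on both sides match.\<close>

lemma palindromic_quotient:
  fixes f q :: "nat \<Rightarrow> real"
  assumes d: "d + 1 = k * (n + 1)" and f: "\<And>m. m > d \<Longrightarrow> f m = 0"
    and N: "N > 0" and q: "\<And>m. m \<le> n * N \<Longrightarrow> q m = q (n * N - m)" "\<And>m. m > n * N \<Longrightarrow> q m = 0"
    and eq: "Abs_fps f * ((1 - fps_X) * (1 - fps_X ^ N) ^ n) = Abs_fps q * (1 - fps_X ^ k) ^ (n + 1)"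
    and j: "j \<le> d"
  shows "f j = f (d - j)"
proof -
  define D where "D = (\<Sum>j\<le>d. monom (f j) j)"
  define Q where "Q = (\<Sum>j\<le>n * N. monom (q j) j)"
  define E where "E = (\<Sum>j\<le>d. monom (f (d - j)) j)"
  have "fps_of_poly (D * ((1 - monom 1 1) * (1 - monom 1 N) ^ n)) = fps_of_poly (Q * (1 - monom 1 k) ^ (n + 1))"
    using eq fps_of_poly_sum_monom[OF f] fps_of_poly_sum_monom[OF q(2)]
    by (simp add: D_def Q_def fps_of_poly_mult fps_of_poly_power fps_of_poly_diff fps_of_poly_monom')
  hence "D * ((1 - monom 1 1) * (1 - monom 1 N) ^ n) = Q * (1 - monom 1 k) ^ (n + 1)"
    by (simp only: fps_of_poly_eq_iff)
  hence "poly (D * ((1 - monom 1 1) * (1 - monom 1 N) ^ n)) t = poly (Q * (1 - monom 1 k) ^ (n + 1)) t" for t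
    by simp
  hence ev: "poly D t * ((1 - t) * (1 - t ^ N) ^ n) = poly Q t * (1 - t ^ k) ^ (n + 1)" for t
    by (simp add: poly_monom)
  \<comment> \<open>Infinitely many points determine a polynomial, so \<open>t > 1\<close> suffices;
    there the factor \<open>?c\<close> is nonzero and can be cancelled.\<close>
  have DE: "poly D t = poly E t" if t: "t > 1" for t
  proof -
    have t0: "t \<noteq> 0" using t by simp
    have "(\<Sum>j\<le>n * N. q (n * N - j) * t ^ j) = (\<Sum>j\<le>n * N. q j * t ^ j)"
      by (rule sum.cong[OF refl], rule arg_cong[of _ _ "\<lambda>z. z * _"], rule q(1)[symmetric]) simp
    hence QR: "t ^ (n * N) * poly Q (1 / t) = poly Q t"
      using sum_power_reflect[OF t0, of "n * N" q] by (simp add: Q_def poly_sum poly_monom)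
    have ER: "t ^ d * poly D (1 / t) = poly E t"
      using sum_power_reflect[OF t0, of d f] by (simp add: D_def E_def poly_sum poly_monom)
    \<comment> \<open>Up to a power of \<open>t\<close>, inversion negates each factor of this
      shape. Both sides contain \<open>n + 1\<close> of them, so the signs agree.\<close>
    have flip: "t ^ m * (1 - (1 / t) ^ m) = - (1 - t ^ m)" for m
      using t0 by (simp add: power_one_over right_diff_distrib)
    have sgn: "e * ((- x) * (- y) ^ n) = (- 1) ^ (n + 1) * (e * (x * y ^ n))" for e x y :: real
      by (simp add: power_minus[of y])
    let ?c = "(1 - t) * (1 - t ^ N) ^ n"
    have "t ^ (n * N) * t ^ (d + 1) * (poly D (1 / t) * ((1 - 1 / t) * (1 - (1 / t) ^ N) ^ n)) =
        poly E t * ((t ^ 1 * (1 - (1 / t) ^ 1)) * (t ^ N * (1 - (1 / t) ^ N)) ^ n)"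
      unfolding ER[symmetric]
      by (simp add: power_mult_distrib power_mult[symmetric] mult_ac del: power_one_over)
    also have "\<dots> = (- 1) ^ (n + 1) * (poly E t * ?c)"
      unfolding flip sgn by simp
    finally have l: "t ^ (n * N) * t ^ (d + 1) * (poly D (1 / t) * ((1 - 1 / t) * (1 - (1 / t) ^ N) ^ n)) =
        (- 1) ^ (n + 1) * (poly E t * ?c)" .
    have "t ^ (n * N) * t ^ (d + 1) * (poly Q (1 / t) * (1 - (1 / t) ^ k) ^ (n + 1)) =
        poly Q t * (t ^ k * (1 - (1 / t) ^ k)) ^ (n + 1)"
      unfolding QR[symmetric] d by (simp only: power_mult_distrib power_mult mult_ac)
    also have "\<dots> = (- 1) ^ (n + 1) * (poly Q t * (1 - t ^ k) ^ (n + 1))"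
      unfolding flip by (simp only: power_minus[of "1 - t ^ k"] mult_ac)
    finally have r: "t ^ (n * N) * t ^ (d + 1) * (poly Q (1 / t) * (1 - (1 / t) ^ k) ^ (n + 1)) =
        (- 1) ^ (n + 1) * (poly Q t * (1 - t ^ k) ^ (n + 1))" .
    have "(- 1) ^ (n + 1) * (poly E t * ?c) = (- 1) ^ (n + 1) * (poly D t * ?c)"
      using l r ev[of "1 / t"] ev[of t] by metis
    moreover have "?c \<noteq> 0"
    proof -
      have "1 - t ^ N \<noteq> 0" using one_less_power[OF t N] by linarith
      thus ?thesis using t by simp
    qed
    ultimately show ?thesis by auto
  qed
  have "D - E = 0"
  proof (rule ccontr)
    assume "D - E \<noteq> 0"
    hence "finite {t. poly (D - E) t = 0}" by (rule poly_roots_finite)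
    moreover have "{1<..} \<subseteq> {t. poly (D - E) t = 0}" using DE by auto
    ultimately have "finite {1::real<..}" by (rule rev_finite_subset)
    thus False using infinite_Ioi by blast
  qed
  hence "coeff D j = coeff E j" by simp
  thus ?thesis using j by (simp add: D_def E_def coeff_sum)
qed

text \<open>Substituting \<open>fps_X ^ k\<close> spreads a series over the multiples of
  \<open>k\<close>, so exponents with remainder \<open>r\<close> come from summand \<open>r\<close>
  alone.\<close>

lemma fps_interleave:
  fixes g :: "nat \<Rightarrow> real fps"
  assumes "k > 0"
  shows "(\<Sum>r<k. fps_X ^ r * (g r oo fps_X ^ k)) = Abs_fps (\<lambda>m. fps_nth (g (m mod k)) (m div k))"
proof (rule fps_ext)
  fix m
  have "fps_nth (fps_X ^ r * (g r oo fps_X ^ k)) m = (if r = m mod k then fps_nth (g r) (m div k) else 0)"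
    if r: "r < k" for r
  proof (cases "m < r")
    case True
    hence "m mod k = m" using r by simp
    thus ?thesis using True by (simp add: fps_X_power_mult_nth)
  next
    case False
    have "k dvd (m - r) \<longleftrightarrow> r = m mod k"
      using False r by (metis mod_eq_dvd_iff_nat mod_less not_less)
    moreover have "(m - m mod k) div k = m div k" by (simp add: minus_mod_eq_mult_div assms)
    ultimately show ?thesis using False by (simp add: fps_X_power_mult_nth fps_nth_compose_X_power)
  qed
  hence "fps_nth (\<Sum>r<k. fps_X ^ r * (g r oo fps_X ^ k)) m =
      (\<Sum>r<k. if r = m mod k then fps_nth (g r) (m div k) else 0)"
    unfolding fps_sum_nth by (intro sum.cong) auto
  thus "fps_nth (\<Sum>r<k. fps_X ^ r * (g r oo fps_X ^ k)) m =
      fps_nth (Abs_fps (\<lambda>m. fps_nth (g (m mod k)) (m div k))) m"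
    using assms by simp
qed

section \<open>Polytopes with a lattice dual\<close>

text \<open>A hyperplane strictly separating an outside point from \<open>P\<close> has negative
  offset \<open>b\<close>, because \<open>0 \<in> P\<close>. Its normal divided by \<open>b\<close>
  lies in the dual and exceeds 1 at that point.\<close>

lemma polar_polar:
  fixes P :: "(real ^ 'n) set"
  assumes "closed P" "convex P" "0 \<in> P"
  shows "x \<in> P \<longleftrightarrow> (\<forall>u\<in>dual_polytope P. u \<bullet> x \<le> 1)"
proof
  assume "x \<in> P"
  thus "\<forall>u\<in>dual_polytope P. u \<bullet> x \<le> 1" by (auto simp: dual_polytope_def)
next
  assume dual: "\<forall>u\<in>dual_polytope P. u \<bullet> x \<le> 1"
  show "x \<in> P"
  proof (rule ccontr)
    assume "x \<notin> P"
    then obtain a b where ab: "a \<bullet> x < b" "\<And>y. y \<in> P \<Longrightarrow> b < a \<bullet> y"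
      using separating_hyperplane_closed_point[OF assms(2,1)] by blast
    have b: "b < 0" using ab(2)[OF assms(3)] by simp
    have "(a /\<^sub>R b) \<bullet> y \<le> 1" if "y \<in> P" for y
      using ab(2)[OF that] b by (simp add: field_simps)
    hence "a /\<^sub>R b \<in> dual_polytope P" by (auto simp: dual_polytope_def)
    hence "(a /\<^sub>R b) \<bullet> x \<le> 1" using dual by blast
    thus False using ab(1) b by (simp add: field_simps)
  qed
qed

text \<open>By the bipolar theorem and Minkowski's theorem, the vertices of the dual give the
  inequalities that cut out \<open>P\<close>. Boundedness of \<open>P\<close> excludes a nonzero
  direction on which all these forms are nonpositive.\<close>

lemma dual_vertices:
  fixes P :: "(real ^ 'n) set"
  assumes P: "compact P" "convex P" "0 \<in> P" and dual: "lattice_polytope (dual_polytope P)"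
  obtains V where "finite V" "V \<noteq> {}" "V \<subseteq> int_lattice"
    "\<And>x. x \<noteq> 0 \<Longrightarrow> \<exists>u\<in>V. u \<bullet> x > 0"
    "\<And>m. dilate m P = {x. \<forall>u\<in>V. u \<bullet> x \<le> real m}"
proof -
  define V where "V = {v. v extreme_point_of dual_polytope P}"
  have poly: "polytope (dual_polytope P)" using dual by (simp add: lattice_polytope_def)
  have hull: "dual_polytope P = convex hull V"
    unfolding V_def using poly by (intro Krein_Milman_Minkowski polytope_imp_compact polytope_imp_convex)
  have fin: "finite V"
    unfolding V_def using poly by (intro finite_polyhedron_extreme_points polytope_imp_polyhedron)
  have "0 \<in> dual_polytope P" by (simp add: dual_polytope_def)
  hence ne: "V \<noteq> {}" unfolding hull by auto
  have lat: "V \<subseteq> int_lattice" using dual by (auto simp: V_def lattice_polytope_def)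
  have mem: "x \<in> P \<longleftrightarrow> (\<forall>u\<in>V. u \<bullet> x \<le> 1)" for x
  proof -
    have "(\<forall>u\<in>convex hull V. u \<bullet> x \<le> 1) \<longleftrightarrow> (\<forall>u\<in>V. u \<bullet> x \<le> 1)"
    proof
      assume *: "\<forall>u\<in>V. u \<bullet> x \<le> 1"
      have "convex hull V \<subseteq> {u. x \<bullet> u \<le> 1}"
        using * by (intro hull_minimal convex_halfspace_le) (auto simp: inner_commute)
      thus "\<forall>u\<in>convex hull V. u \<bullet> x \<le> 1" by (auto simp: inner_commute)
    qed (auto intro: hull_inc)
    thus ?thesis using polar_polar[OF compact_imp_closed[OF P(1)] P(2,3)] by (simp add: hull)
  qed
  have pos: "\<exists>u\<in>V. u \<bullet> x > 0" if "x \<noteq> 0" for x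
  proof (rule ccontr)
    assume "\<not> (\<exists>u\<in>V. u \<bullet> x > 0)"
    hence np: "\<And>u. u \<in> V \<Longrightarrow> u \<bullet> x \<le> 0" by (meson not_le)
    obtain b where b: "b > 0" "\<And>y. y \<in> P \<Longrightarrow> norm y \<le> b"
      using compact_imp_bounded[OF P(1)] by (auto simp: bounded_pos)
    \<comment> \<open>This multiple of \<open>x\<close> satisfies all inequalities of
      \<open>P\<close> but has norm \<open>2 * b\<close>, beyond the bound.\<close>
    define c where "c = 2 * b / norm x"
    have c: "c > 0" using b(1) that by (simp add: c_def)
    have "u \<bullet> (c *\<^sub>R x) \<le> 1" if "u \<in> V" for u
      using mult_nonneg_nonpos[of c "u \<bullet> x"] np[OF that] c by simp
    hence "norm (c *\<^sub>R x) \<le> b" using b(2) mem by blast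
    moreover have "norm (c *\<^sub>R x) = 2 * b" using that b(1) by (simp add: c_def)
    ultimately show False using b(1) by simp
  qed
  have dil: "dilate m P = {x. \<forall>u\<in>V. u \<bullet> x \<le> real m}" for m
  proof (cases "m = 0")
    \<comment> \<open>Division by \<open>m\<close> is impossible here; instead, \<open>pos\<close>
      shows that only the origin solves the system.\<close>
    case True
    have "dilate m P = {0}" using True P(3) by (auto simp: dilate_def)
    moreover have "{x. \<forall>u\<in>V. u \<bullet> x \<le> real m} = {0}"
    proof -
      have "x = 0" if "\<forall>u\<in>V. u \<bullet> x \<le> real m" for x
        using pos[of x] that True by force
      thus ?thesis by auto
    qed
    ultimately show ?thesis by simp
  next
    case False
    have "x \<in> dilate m P \<longleftrightarrow> (\<forall>u\<in>V. u \<bullet> x \<le> real m)" for x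
    proof -
      have "x \<in> dilate m P \<longleftrightarrow> x /\<^sub>R real m \<in> P"
      proof
        assume "x /\<^sub>R real m \<in> P"
        thus "x \<in> dilate m P"
          using False unfolding dilate_def by (intro image_eqI[of _ _ "x /\<^sub>R real m"]) simp_all
      qed (use False in \<open>auto simp: dilate_def\<close>)
      thus ?thesis using False by (simp add: mem field_simps)
    qed
    thus ?thesis by blast
  qed
  show ?thesis by (rule that[OF fin ne lat pos dil])
qed

text \<open>Multiplication by \<open>1 - fps_X\<close> takes successive differences. The forms in
  \<open>V\<close> are integral on the lattice, so lattice points new at stage \<open>m\<close> have
  maximum exactly \<open>m\<close>.\<close>

lemma lattice_count_series:
  fixes P :: "(real ^ 'n) set"
  assumes P: "compact P"
    and V: "V \<noteq> {}" "V \<subseteq> int_lattice"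
      "\<And>x. x \<noteq> 0 \<Longrightarrow> \<exists>u\<in>V. u \<bullet> x > 0" "\<And>m. dilate m P = {x. \<forall>u\<in>V. u \<bullet> x \<le> real m}"
  shows "Abs_fps (\<lambda>m. real (lattice_count P m)) * (1 - fps_X) =
    Abs_fps (\<lambda>m. real (card {x \<in> int_lattice. (\<forall>u\<in>V. u \<bullet> x \<le> real m) \<and> (\<exists>u\<in>V. u \<bullet> x = real m)}))"
    (is "_ = Abs_fps (\<lambda>m. real (card (?Z m)))")
proof (rule fps_ext)
  fix m
  let ?A = "\<lambda>m. dilate m P \<inter> int_lattice"
  have fin: "finite (?A j)" for j
  proof (rule finite_bounded_int_lattice)
    show "bounded (dilate j P)"
      unfolding dilate_def by (rule bounded_scaling) (rule compact_imp_bounded[OF P])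
  qed
  have "real (lattice_count P m) - (if m = 0 then 0 else real (lattice_count P (m - 1))) = real (card (?Z m))"
  proof (cases m)
    \<comment> \<open>There is no earlier stage. The origin is the only solution, and nonemptiness
      of \<open>V\<close> supplies a form attaining 0.\<close>
    case 0
    have "?A 0 = ?Z 0"
    proof -
      have "\<exists>u\<in>V. u \<bullet> x = 0" if "\<forall>u\<in>V. u \<bullet> x \<le> 0" for x
      proof -
        have "x = 0" using V(3)[of x] that by force
        thus ?thesis using V(1) by auto
      qed
      thus ?thesis unfolding V(4) by auto
    qed
    thus ?thesis using 0 by (simp add: lattice_count_def)
  next
    case (Suc j)
    have "?A m = ?A j \<union> ?Z m"
    proof (intro set_eqI iffI)
      fix x assume x: "x \<in> ?A m"
      show "x \<in> ?A j \<union> ?Z m"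
      proof (cases "x \<in> ?A j")
        case False
        then obtain u where u: "u \<in> V" "u \<bullet> x > real j" using x unfolding V(4) by (auto simp: not_le)
        \<comment> \<open>An integer above \<open>j\<close> and at most \<open>Suc j\<close> can
          only be \<open>Suc j\<close>.\<close>
        have "u \<bullet> x \<in> \<int>" using int_lattice_inner u(1) V(2) x by blast
        then obtain z where z: "u \<bullet> x = of_int z" by (auto elim: Ints_cases)
        have "u \<bullet> x \<le> real m" using x u(1) unfolding V(4) by blast
        hence "z \<le> int m" unfolding z by linarith
        moreover have "int j < z" using u(2) unfolding z by linarith
        ultimately have "u \<bullet> x = real m" unfolding z Suc by simp
        thus ?thesis using x u(1) unfolding V(4) by blast
      qed simp
    next
      fix x assume "x \<in> ?A j \<union> ?Z m"
      thus "x \<in> ?A m" unfolding V(4) Suc by fastforce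
    qed
    moreover have "?A j \<inter> ?Z m = {}" unfolding V(4) Suc by fastforce
    moreover have "finite (?Z m)"
      using fin[of m] by (rule rev_finite_subset) (auto simp: V(4))
    ultimately have "card (?A m) = card (?A j) + card (?Z m)"
      using card_Un_disjoint[OF fin[of j]] by simp
    thus ?thesis using Suc by (simp add: lattice_count_def)
  qed
  thus "fps_nth (Abs_fps (\<lambda>m. real (lattice_count P m)) * (1 - fps_X)) m = fps_nth (Abs_fps (\<lambda>m. real (card (?Z m)))) m"
    by (cases m) (simp_all add: right_diff_distrib)
qed

section \<open>Symmetry of the numerators across residue classes\<close>

theorem theorem2p1:
  fixes P :: "(real ^ 'n) set"
    and k n :: nat
    and L :: "nat \<Rightarrow> real poly"
    and \<delta> :: "nat \<Rightarrow> nat \<Rightarrow> int"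
  assumes n: "n = CARD('n)"
    and P_rational: "rational_polytope P"
    and P_dim: "aff_dim P = int n"
    and P_origin: "0 \<in> P"
    and P_dual: "lattice_polytope (dual_polytope P)"
    and k: "k = (LEAST j. 0 < j \<and> lattice_polytope (dilate j P))"
    and L_degree: "\<And>r. r < k \<Longrightarrow> degree (L r) = n"
    and L_count: "\<And>r l. r < k \<Longrightarrow> poly (L r) (real l) = real (lattice_count P (l * k + r))"
    and delta: "\<And>r. r < k \<Longrightarrow>
          Abs_fps (\<lambda>l. poly (L r) (real l)) =
          (\<Sum>i\<le>n. fps_const (of_int (\<delta> i r)) * fps_X ^ i) / (1 - fps_X) ^ (n + 1)"
  shows "\<forall>i r. i \<le> n \<and> r < k \<longrightarrow> \<delta> i r = \<delta> (n - i) (k - r - 1)"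
proof (intro allI impI)
  fix i r assume ir: "i \<le> n \<and> r < k"
  hence k0: "k > 0" by simp
  \<comment> \<open>The largest exponent, \<open>n * k + (k - 1)\<close>, of the interleaved
    numerator.\<close>
  define d where "d = k * (n + 1) - 1"
  have d: "d + 1 = k * (n + 1)" using k0 by (simp add: d_def)
  obtain W where W: "finite W" "P = convex hull W"
    using P_rational by (auto simp: rational_polytope_def)
  have P: "compact P" "convex P"
    using W by (auto simp: finite_imp_compact_convex_hull)
  obtain V where V: "finite V" "V \<noteq> {}" "V \<subseteq> int_lattice"
    "\<And>x. x \<noteq> 0 \<Longrightarrow> \<exists>u\<in>V. u \<bullet> x > 0" "\<And>m. dilate m P = {x. \<forall>u\<in>V. u \<bullet> x \<le> real m}"
    using dual_vertices[OF P P_origin P_dual] by blast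
  let ?Z = "Abs_fps (\<lambda>m. real (card {x \<in> int_lattice. (\<forall>u\<in>V. u \<bullet> x \<le> real m) \<and> (\<exists>u\<in>V. u \<bullet> x = real m)}))"
  obtain N q where N: "N > 0" and q: "\<And>m. m \<le> n * N \<Longrightarrow> q m = q (n * N - m)" "\<And>m. m > n * N \<Longrightarrow> q m = 0"
    and Zq: "?Z * (1 - fps_X ^ N) ^ n = Abs_fps q"
    using gauge_series_palindromic[OF V(1-4)] unfolding n by blast
  define G where "G = Abs_fps (\<lambda>m. real (lattice_count P m))"
  have GZ: "G * (1 - fps_X) = ?Z"
    unfolding G_def by (rule lattice_count_series[OF P(1) V(2-5)])
  \<comment> \<open>Interleaving the numerators puts \<open>\<delta> i r\<close> at exponent
    \<open>i * k + r\<close>; the coefficients are 0 once the quotient exceeds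
    \<open>n\<close>.\<close>
  define f where "f m = (if m div k \<le> n then of_int (\<delta> (m div k) (m mod k)) else 0 :: real)" for m
  have GD: "G * (1 - fps_X ^ k) ^ (n + 1) = Abs_fps f"
  proof -
    let ?l = "\<lambda>r. Abs_fps (\<lambda>l. poly (L r) (real l))"
    let ?D = "\<lambda>r. \<Sum>i\<le>n. fps_const (of_int (\<delta> i r)) * fps_X ^ i :: real fps"
    have G: "G = (\<Sum>r<k. fps_X ^ r * (?l r oo fps_X ^ k))"
      unfolding fps_interleave[OF k0] G_def using k0 by (simp add: L_count)
    have "fps_X ^ r * (?l r oo fps_X ^ k) * (1 - fps_X ^ k) ^ (n + 1) =
        fps_X ^ r * (?D r oo fps_X ^ k)" if r: "r < k" for r
    proof -
      have X0: "fps_nth (fps_X ^ k :: real fps) 0 = 0" using k0 by simp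
      \<comment> \<open>The denominator has constant term 1, so the division in \<open>delta\<close>
        is exact and can be undone.\<close>
      have "is_unit ((1 - fps_X) ^ (n + 1) :: real fps)"
        by (simp add: fps_is_unit_iff)
      hence "?l r * (1 - fps_X) ^ (n + 1) = ?D r"
        unfolding delta[OF r] by (rule dvd_div_mult_self[OF unit_imp_dvd])
      hence "(?l r * (1 - fps_X) ^ (n + 1)) oo fps_X ^ k = ?D r oo fps_X ^ k" by simp
      hence "(?l r oo fps_X ^ k) * (1 - fps_X ^ k) ^ (n + 1) = ?D r oo fps_X ^ k"
        by (simp only: fps_compose_mult_distrib[OF X0] fps_compose_power[OF X0, symmetric]
          fps_compose_sub_distrib fps_compose_1 fps_X_fps_compose_startby0[OF X0])
      thus ?thesis by (simp add: mult.assoc)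
    qed
    hence "G * (1 - fps_X ^ k) ^ (n + 1) = (\<Sum>r<k. fps_X ^ r * (?D r oo fps_X ^ k))"
      unfolding G sum_distrib_right by (intro sum.cong refl) (simp only: lessThan_iff)
    also have "\<dots> = Abs_fps f"
    proof -
      have "fps_nth (?D r) j = (if j \<le> n then of_int (\<delta> j r) else 0)" for r j
        by (simp add: fps_sum_nth if_distrib[of "\<lambda>x. _ * x"] cong: if_cong)
      thus ?thesis unfolding fps_interleave[OF k0] f_def by simp
    qed
    finally show ?thesis .
  qed
  \<comment> \<open>\<open>G\<close> times the product of both denominators is evaluated in two
    ways.\<close>
  have eq: "Abs_fps f * ((1 - fps_X) * (1 - fps_X ^ N) ^ n) = Abs_fps q * (1 - fps_X ^ k) ^ (n + 1)"
    unfolding GD[symmetric] Zq[symmetric] GZ[symmetric] by (simp only: mult_ac)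
  have f0: "f m = 0" if "m > d" for m
  proof -
    have "m div k \<ge> n + 1" using that d k0 by (simp add: less_eq_div_iff_mult_less_eq mult.commute)
    thus ?thesis by (simp add: f_def)
  qed
  \<comment> \<open>Subtraction from \<open>d\<close> complements quotient and remainder separately:
    \<open>i\<close> becomes \<open>n - i\<close> and \<open>r\<close> becomes
    \<open>k - r - 1\<close>.\<close>
  have ik: "i * k + r + ((n - i) * k + (k - r - 1)) = d"
  proof -
    obtain e where e: "n = i + e" using ir le_Suc_ex by blast
    show ?thesis using ir d unfolding e by (simp add: algebra_simps)
  qed
  have "f (i * k + r) = f (d - (i * k + r))"
    by (rule palindromic_quotient[where f = f and q = q, OF d f0 N q eq]) (use ik in simp_all)
  moreover have "d - (i * k + r) = (n - i) * k + (k - r - 1)" using ik by simp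
  moreover have "f (a * k + b) = of_int (\<delta> a b)" if "a \<le> n" "b < k" for a b
    using that by (simp add: f_def)
  from this[of i r] this[of "n - i" "k - r - 1"]
  have "f (i * k + r) = of_int (\<delta> i r)"
    "f ((n - i) * k + (k - r - 1)) = of_int (\<delta> (n - i) (k - r - 1))"
    using ir by auto
  ultimately show "\<delta> i r = \<delta> (n - i) (k - r - 1)" by simp
qed

end
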